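(* For every finite simple graph $G$, $\tau^\dagger(G) \ge \dfrac{\tau(G)}{2}$, where $\tau(G)$ is the minimum size of a triangle cover of $G$ and $\tau^\dagger(G)$ is the optimal value of its second theta body relaxation.
   Context: Let $G$ be a finite simple graph with edge set $E$. A triangle cover of $G$ is a set of edges of $G$ containing at least one edge from every triangle of $G$; $\tau(G)$ is the minimum number of edges in a triangle cover of $G$. Let $I \subseteq \mathbb{R}[x_e : e \in E]$ be the vanishing ideal of the set of characteristic vectors in $\{0,1\}^E$ of the triangle covers of $G$. Define $$\tau^\dagger(G) = \min\left\{\sum_{e \in E} x_e : x \in \mathrm{TH}_2(I)\right\}.$$ For an ideal $I$ of a polynomial ring $\mathbb{R}[x_1,\dots,x_N]$, a polynomial $f$ is $k$-sos mod $I$ if there are polynomials $g_1,\dots,g_m$ of degree at most $k$ with $f - \sum_{j=1}^m g_j^2 \in I$. The $k$-th theta body of $I$ is $$\mathrm{TH}_k(I) = \{x \in \mathbb{R}^N : f(x) \ge 0 \text{ for all } f \text{ of degree at most } 1 \text{ (affine linear) that are } k\text{-sos mod } I\}.$$ *)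

theory Defs
  imports "HOL-Analysis.Analysis" "HOL-Library.Poly_Mapping" "HOL-Library.FuncSet"
begin

definition finite_simple_graph :: "'a set \<Rightarrow> 'a set set \<Rightarrow> bool" where
  "finite_simple_graph V E \<longleftrightarrow> finite V \<and> (\<forall>e\<in>E. e \<subseteq> V \<and> card e = 2)"

definition is_triangle :: "'a set set \<Rightarrow> 'a \<Rightarrow> 'a \<Rightarrow> 'a \<Rightarrow> bool" where
  "is_triangle E u v w \<longleftrightarrow>
     u \<noteq> v \<and> v \<noteq> w \<and> u \<noteq> w \<and> {u, v} \<in> E \<and> {v, w} \<in> E \<and> {u, w} \<in> E"

definition triangle_cover :: "'a set set \<Rightarrow> 'a set set \<Rightarrow> bool" where
  "triangle_cover E C \<longleftrightarrow>
     C \<subseteq> E \<and> (\<forall>u v w. is_triangle E u v w \<longrightarrow> {u, v} \<in> C \<or> {v, w} \<in> C \<or> {u, w} \<in> C)"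

definition tau :: "'a set set \<Rightarrow> nat" where
  "tau E = Min (card ` {C. triangle_cover E C})"

text \<open>
  Real polynomials with variables indexed by a type: a monomial is a finitely supported
  exponent function, and a polynomial is a finitely supported coefficient function on monomials.
  The ring structure is the one of \<^theory>\<open>HOL-Library.Poly_Mapping\<close>.
\<close>

type_synonym 'v rpoly = "('v \<Rightarrow>\<^sub>0 nat) \<Rightarrow>\<^sub>0 real"

definition poly_ring :: "'v set \<Rightarrow> 'v rpoly set" where
  "poly_ring N = {p. \<forall>m\<in>Poly_Mapping.keys p. Poly_Mapping.keys m \<subseteq> N}"

definition monom_degree :: "('v \<Rightarrow>\<^sub>0 nat) \<Rightarrow> nat" where
  "monom_degree m = (\<Sum>v\<in>Poly_Mapping.keys m. Poly_Mapping.lookup m v)"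

text \<open>The zero polynomial gets degree 0.\<close>

definition total_degree :: "'v rpoly \<Rightarrow> nat" where
  "total_degree p = Max (insert 0 (monom_degree ` Poly_Mapping.keys p))"

definition eval_poly :: "('v \<Rightarrow> real) \<Rightarrow> 'v rpoly \<Rightarrow> real" where
  "eval_poly x p =
     (\<Sum>m\<in>Poly_Mapping.keys p. Poly_Mapping.lookup p m *
        (\<Prod>v\<in>Poly_Mapping.keys m. x v ^ Poly_Mapping.lookup m v))"

definition vanishing_ideal :: "'v set \<Rightarrow> ('v \<Rightarrow> real) set \<Rightarrow> 'v rpoly set" where
  "vanishing_ideal N S = {p \<in> poly_ring N. \<forall>x\<in>S. eval_poly x p = 0}"

definition k_sos_mod :: "'v set \<Rightarrow> nat \<Rightarrow> 'v rpoly set \<Rightarrow> 'v rpoly \<Rightarrow> bool" where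
  "k_sos_mod N k I f \<longleftrightarrow>
     (\<exists>(m::nat) g. (\<forall>j<m. g j \<in> poly_ring N \<and> total_degree (g j) \<le> k) \<and>
        f - (\<Sum>j<m. (g j)\<^sup>2) \<in> I)"

text \<open>
  Points of the real vector space with coordinates in N are the functions that are
  \<^term>\<open>undefined\<close> outside N.
\<close>

definition theta_body :: "'v set \<Rightarrow> nat \<Rightarrow> 'v rpoly set \<Rightarrow> ('v \<Rightarrow> real) set" where
  "theta_body N k I =
     {x \<in> N \<rightarrow>\<^sub>E UNIV.
        \<forall>f\<in>poly_ring N. total_degree f \<le> 1 \<longrightarrow> k_sos_mod N k I f \<longrightarrow> 0 \<le> eval_poly x f}"

definition char_vec :: "'v set \<Rightarrow> 'v set \<Rightarrow> 'v \<Rightarrow> real" where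
  "char_vec N C = restrict (indicator C) N"

definition cover_ideal :: "'a set set \<Rightarrow> 'a set rpoly set" where
  "cover_ideal E = vanishing_ideal E (char_vec E ` {C. triangle_cover E C})"

text \<open>The minimum is expressed by \<^const>\<open>Least\<close> because the set of values is infinite in general.\<close>

definition tau_dagger :: "'a set set \<Rightarrow> real" where
  "tau_dagger E = (LEAST t. t \<in> (\<lambda>x. \<Sum>e\<in>E. x e) ` theta_body E 2 (cover_ideal E))"

end

(* Modulo the cover ideal the edge constraints 0 <= x_e <= 1 and the triangle constraints
   x_e + x_f + x_g >= 1 are 2-sos, so the second theta body consists of fractional triangle covers,
   and Krivelevich's inequality tau <= 2 tau* applies.  The latter is proved by induction on the
   number of edges.  If the weight of a fractional cover g is at least |E|/4, the edges inside the
   two sides of a large cut form a cover of size at most |E|/2.  Otherwise push g away from the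
   constant 1/3 until some edge e gets weight 0, which does not increase the total weight.  If e
   lies in a triangle, another edge of it has weight at least 1/2 and is put into the cover; if
   not, e can be deleted. *)
theory Submission
  imports Defs
begin

section \<open>Fractional triangle covers\<close>

text \<open>Greedy cut: vertices are placed one at a time, each on the side that cuts at least half
  of its edges to the vertices placed before. The two sides are \<open>S\<close> and its
  complement.\<close>

lemma ex_large_cut:
  assumes "finite V" "\<And>e. e \<in> E \<Longrightarrow> e \<subseteq> V \<and> card e = 2"
  shows "\<exists>S. 2 * card {e \<in> E. e \<subseteq> S \<or> e \<inter> S = {}} \<le> card E"
  using assms
proof (induction V arbitrary: E rule: finite_induct)
  case empty
  then have "E = {}" by fastforce
  then show ?case by simp
next
  case (insert v V)
  define E' where "E' = {e \<in> E. v \<notin> e}"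
  define F where "F = {e \<in> E. v \<in> e}"
  have "E \<subseteq> Pow (insert v V)" using insert.prems by blast
  then have fin: "finite E" using insert.hyps(1) by (meson finite_Pow_iff finite_insert finite_subset)
  then have fin': "finite E'" "finite F" by (auto simp: E'_def F_def)
  have cE: "card E = card E' + card F"
  proof -
    have "E = E' \<union> F" "E' \<inter> F = {}" by (auto simp: E'_def F_def)
    then show ?thesis using fin' by (metis card_Un_disjoint)
  qed
  have "\<exists>S. 2 * card {e \<in> E'. e \<subseteq> S \<or> e \<inter> S = {}} \<le> card E'"
    using insert.prems by (intro insert.IH) (auto simp: E'_def)
  then obtain S where S: "2 * card {e \<in> E'. e \<subseteq> S \<or> e \<inter> S = {}} \<le> card E'" by blast
  \<comment> \<open>\<open>T\<close> is the new side and \<open>F1\<close> bounds the edges at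
    \<open>v\<close> that it leaves uncut; edges avoiding \<open>v\<close> must be treated by
    \<open>T\<close> as by \<open>S\<close>.\<close>
  have step: ?case if F1: "F1 \<subseteq> F" "2 * card F1 \<le> card F"
    and T: "\<And>e. e \<in> E' \<Longrightarrow> (e \<subseteq> T \<or> e \<inter> T = {}) = (e \<subseteq> S \<or> e \<inter> S = {})"
      "\<And>e. e \<in> F \<Longrightarrow> e \<subseteq> T \<or> e \<inter> T = {} \<Longrightarrow> e \<in> F1" for T F1
  proof -
    have "{e \<in> E. e \<subseteq> T \<or> e \<inter> T = {}} \<subseteq> {e \<in> E'. e \<subseteq> S \<or> e \<inter> S = {}} \<union> F1" (is "?A \<subseteq> ?B \<union> _")
    proof
      fix e assume e: "e \<in> ?A"
      show "e \<in> ?B \<union> F1"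
      proof (cases "v \<in> e")
        case True
        then show ?thesis using e T(2)[of e] by (auto simp: F_def)
      next
        case False
        then have "e \<in> E'" using e by (auto simp: E'_def)
        then show ?thesis using e T(1)[of e] by auto
      qed
    qed
    moreover have "finite (?B \<union> F1)" using fin' F1 finite_subset by auto
    ultimately have "card ?A \<le> card (?B \<union> F1)" by (rule card_mono[rotated])
    also have "\<dots> \<le> card ?B + card F1" by (rule card_Un_le)
    finally have "2 * card ?A \<le> card E" using S F1 cE by linarith
    then show ?thesis by blast
  qed
  \<comment> \<open>\<open>A\<close> holds the edges at \<open>v\<close> left uncut if
    \<open>v\<close> joins \<open>S\<close>, and \<open>B\<close> those left uncut if
    \<open>v\<close> stays outside; one of them has at most half of \<open>F\<close>.\<close>
  define A where "A = {e \<in> F. e - {v} \<subseteq> S}"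
  define B where "B = F - A"
  have "card A + card B = card F"
    using fin' unfolding B_def A_def by (metis (no_types, lifting) card_Diff_subset card_mono
        finite_subset le_add_diff_inverse mem_Collect_eq subsetI)
  then consider "2 * card A \<le> card F" | "2 * card B \<le> card F" by linarith
  then show ?case
  proof cases
    case 1
    show ?thesis
    proof (rule step[of A "insert v S"])
      show "A \<subseteq> F" by (auto simp: A_def)
    qed (use 1 in \<open>auto simp: A_def E'_def F_def\<close>)
  next
    case 2
    show ?thesis
    \<comment> \<open>The induction hypothesis does not place \<open>S\<close> inside
      \<open>V\<close>, so \<open>v\<close> is removed explicitly.\<close>
    proof (rule step[of B "S - {v}"])
      fix e assume e: "e \<in> F" "e \<subseteq> S - {v} \<or> e \<inter> (S - {v}) = {}"
      then have "v \<in> e" "card e = 2" using insert.prems by (auto simp: F_def)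
      then obtain u where "e = {v, u}" "u \<noteq> v" by (metis card_2_iff doubleton_eq_iff insertE singletonD)
      then show "e \<in> B" using e by (auto simp: B_def A_def)
    qed (use 2 in \<open>auto simp: B_def E'_def F_def\<close>)
  qed
qed

text \<open>Two of the three vertices of a triangle lie on the same side of the cut.\<close>

lemma cut_triangle_cover:
  "triangle_cover E {e \<in> E. e \<subseteq> S \<or> e \<inter> S = {}}"
  unfolding triangle_cover_def is_triangle_def by auto

section \<open>Fractional covers and Krivelevich's inequality\<close>

definition fractional_cover :: "'a set set \<Rightarrow> ('a set \<Rightarrow> real) \<Rightarrow> bool" where
  "fractional_cover E g \<longleftrightarrow> (\<forall>e\<in>E. 0 \<le> g e) \<and>
     (\<forall>u v w. is_triangle E u v w \<longrightarrow> 1 \<le> g {u, v} + g {v, w} + g {u, w})"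

lemma fractional_cover_subset:
  "fractional_cover E g \<Longrightarrow> D \<subseteq> E \<Longrightarrow> fractional_cover D g"
  unfolding fractional_cover_def is_triangle_def by (meson subsetD)

lemma finite_simple_graph_finite: "finite_simple_graph V E \<Longrightarrow> finite E"
  unfolding finite_simple_graph_def by (meson Pow_iff finite_Pow_iff finite_subset subsetI)

lemma triangle_cover_insert:
  assumes "triangle_cover (E - {a}) C" "a \<in> E"
  shows "triangle_cover E (insert a C)"
  unfolding triangle_cover_def
proof (intro conjI allI impI)
  show "insert a C \<subseteq> E" using assms by (auto simp: triangle_cover_def)
next
  fix u v w assume "is_triangle E u v w"
  then have "a = {u, v} \<or> a = {v, w} \<or> a = {u, w} \<or> is_triangle (E - {a}) u v w"
    unfolding is_triangle_def by blast
  then show "{u, v} \<in> insert a C \<or> {v, w} \<in> insert a C \<or> {u, w} \<in> insert a C"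
    using assms(1) unfolding triangle_cover_def by blast
qed

text \<open>The affine map taking \<open>m\<close> to 0 and fixing 1/3 is increasing, so it
  preserves the condition that a triangle has average weight at least 1/3. As the overall average is
  at most 1/3, the map can only lower it.\<close>

lemma fractional_cover_shift:
  assumes g: "fractional_cover E g" and m: "\<And>e. e \<in> E \<Longrightarrow> m \<le> g e" "0 \<le> m" "m < 1/3"
    and sum: "3 * sum g E \<le> card E"
  shows "fractional_cover E (\<lambda>e. (g e - m) / (1 - 3 * m))"
    and "(\<Sum>e\<in>E. (g e - m) / (1 - 3 * m)) \<le> sum g E"
proof -
  have pos: "0 < 1 - 3 * m" using m by simp
  show "fractional_cover E (\<lambda>e. (g e - m) / (1 - 3 * m))"
    unfolding fractional_cover_def
  proof (intro conjI ballI allI impI)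
    fix e assume "e \<in> E"
    then show "0 \<le> (g e - m) / (1 - 3 * m)" using m pos by simp
  next
    fix u v w assume "is_triangle E u v w"
    then have "1 \<le> g {u, v} + g {v, w} + g {u, w}" using g by (auto simp: fractional_cover_def)
    then have "1 - 3 * m \<le> (g {u, v} - m) + (g {v, w} - m) + (g {u, w} - m)" by simp
    then show "1 \<le> (g {u, v} - m) / (1 - 3 * m) + (g {v, w} - m) / (1 - 3 * m) + (g {u, w} - m) / (1 - 3 * m)"
      using pos by (simp flip: add_divide_distrib)
  qed
  have "(\<Sum>e\<in>E. (g e - m) / (1 - 3 * m)) = (sum g E - card E * m) / (1 - 3 * m)"
    by (simp add: sum_subtractf flip: sum_divide_distrib)
  also have "\<dots> \<le> sum g E"
  proof -
    have "3 * sum g E * m \<le> card E * m" using sum m by (intro mult_right_mono) auto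
    then show ?thesis using pos by (simp add: pos_divide_le_eq algebra_simps)
  qed
  finally show "(\<Sum>e\<in>E. (g e - m) / (1 - 3 * m)) \<le> sum g E" .
qed

text \<open>Krivelevich's inequality for every fractional cover instead of an optimal one: the
  induction changes the weights together with the edge set.\<close>

theorem ex_triangle_cover_le_fractional:
  assumes "finite_simple_graph V E" "fractional_cover E g"
  shows "\<exists>C. triangle_cover E C \<and> real (card C) \<le> 2 * sum g E"
  using assms
proof (induction "card E" arbitrary: E g rule: less_induct)
  case less
  note fin = finite_simple_graph_finite[OF less.prems(1)]
  show ?case
  proof (cases "real (card E) \<le> 4 * sum g E")
    case True
    obtain S where S: "2 * card {e \<in> E. e \<subseteq> S \<or> e \<inter> S = {}} \<le> card E"
      using ex_large_cut[of V E] less.prems(1) unfolding finite_simple_graph_def by blast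
    then have "real (card {e \<in> E. e \<subseteq> S \<or> e \<inter> S = {}}) \<le> 2 * sum g E" using True by linarith
    then show ?thesis using cut_triangle_cover by blast
  next
    case False
    have "0 \<le> sum g E" using less.prems(2) by (auto simp: fractional_cover_def intro: sum_nonneg)
    then have sum3: "3 * sum g E \<le> card E" using False by simp
    have "E \<noteq> {}" using False by auto
    \<comment> \<open>Shifting by the minimum weight makes the weight of \<open>e\<close> zero and
      keeps all others nonnegative. The minimum is at most the average, which is below 1/4, so
      \<open>1 - 3 * g e\<close> is positive.\<close>
    then obtain e where e: "e \<in> E" "\<And>e'. e' \<in> E \<Longrightarrow> g e \<le> g e'"
      using fin by (metis arg_min_if_finite(1) arg_min_least)
    have "card E * g e \<le> sum g E" using sum_bounded_below[of E "g e" g] e by simp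
    then have "card E * g e < card E * (1/4)" using False by simp
    then have "g e < 1/4" by (rule mult_left_less_imp_less) simp
    then have small: "g e < 1/3" by simp
    have nn: "0 \<le> g e" using e less.prems(2) by (auto simp: fractional_cover_def)
    define h where "h = (\<lambda>e'. (g e' - g e) / (1 - 3 * g e))"
    have h: "fractional_cover E h" "sum h E \<le> sum g E" and he: "h e = 0"
      using fractional_cover_shift[OF less.prems(2) e(2) nn small sum3] by (auto simp: h_def)
    have IH: "\<exists>C. triangle_cover (E - {a}) C \<and> real (card C) \<le> 2 * (sum h E - h a)" if "a \<in> E" for a
    proof -
      have "\<exists>C. triangle_cover (E - {a}) C \<and> real (card C) \<le> 2 * sum h (E - {a})"
      proof (rule less.hyps)
        show "card (E - {a}) < card E" using fin that by (rule card_Diff1_less)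
        show "finite_simple_graph V (E - {a})" using less.prems(1) by (auto simp: finite_simple_graph_def)
        show "fractional_cover (E - {a}) h" using h(1) by (rule fractional_cover_subset) auto
      qed
      then show ?thesis using fin that by (simp add: sum_diff1)
    qed
    show ?thesis
    \<comment> \<open>The split is on a heavy edge anywhere in \<open>E\<close>; without one,
      \<open>e\<close> can lie in no triangle.\<close>
    proof (cases "\<exists>a\<in>E. 1/2 \<le> h a")
      case True
      then obtain a where a: "a \<in> E" "1/2 \<le> h a" by blast
      then obtain C where C: "triangle_cover (E - {a}) C" "real (card C) \<le> 2 * (sum h E - h a)"
        using IH by blast
      \<comment> \<open>Deleting \<open>a\<close> lowers the doubled weight by at least 1, which
        pays for adding \<open>a\<close> to the cover.\<close>
      have "card (insert a C) \<le> Suc (card C)"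
        by (cases "finite C") (simp_all add: card_insert_if)
      then have "real (card (insert a C)) \<le> real (card C) + 1" by linarith
      then have "real (card (insert a C)) \<le> 2 * sum g E" using C(2) a(2) h(2) by argo
      then show ?thesis using triangle_cover_insert[OF C(1) a(1)] by blast
    next
      case False
      \<comment> \<open>In a triangle through \<open>e\<close> the other two weights would have to
        sum to at least 1, though each is below 1/2.\<close>
      have notri: "is_triangle (E - {e}) u v w" if t: "is_triangle E u v w" for u v w
      proof (rule ccontr)
        assume "\<not> is_triangle (E - {e}) u v w"
        then have "e = {u, v} \<or> e = {v, w} \<or> e = {u, w}" using t by (auto simp: is_triangle_def)
        moreover have "1 \<le> h {u, v} + h {v, w} + h {u, w}" using h(1) t by (auto simp: fractional_cover_def)
        moreover have "h {u, v} < 1/2" "h {v, w} < 1/2" "h {u, w} < 1/2"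
          using False t unfolding is_triangle_def by force+
        ultimately show "False" using he by auto
      qed
      obtain C where C: "triangle_cover (E - {e}) C" "real (card C) \<le> 2 * (sum h E - h e)"
        using IH e(1) by blast
      have "triangle_cover E C" using C(1) notri unfolding triangle_cover_def by blast
      moreover have "real (card C) \<le> 2 * sum g E" using C(2) he h(2) by simp
      ultimately show ?thesis by blast
    qed
  qed
qed

lemma tau_le_card:
  assumes "finite E" "triangle_cover E C"
  shows "tau E \<le> card C"
proof -
  have "{C. triangle_cover E C} \<subseteq> Pow E" by (auto simp: triangle_cover_def)
  then have "finite {C. triangle_cover E C}" using assms(1) by (meson finite_Pow_iff finite_subset)
  then show ?thesis using assms(2) unfolding tau_def by (intro Min_le) auto
qed

section \<open>Evaluation and degree of polynomials\<close>

definition monom_eval :: "('v \<Rightarrow> real) \<Rightarrow> ('v \<Rightarrow>\<^sub>0 nat) \<Rightarrow> real" where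
  "monom_eval x m = (\<Prod>v\<in>Poly_Mapping.keys m. x v ^ Poly_Mapping.lookup m v)"

text \<open>Allows two monomials with different supports to be evaluated over one common index set;
  \<open>eval_poly_superset\<close> and \<open>monom_degree_superset\<close> serve the same
  end.\<close>

lemma monom_eval_superset:
  assumes "finite A" "Poly_Mapping.keys m \<subseteq> A"
  shows "monom_eval x m = (\<Prod>v\<in>A. x v ^ Poly_Mapping.lookup m v)"
  unfolding monom_eval_def using assms by (intro prod.mono_neutral_left) (auto simp: in_keys_iff)

lemma monom_eval_add: "monom_eval x (m + n) = monom_eval x m * monom_eval x n"
proof -
  let ?A = "Poly_Mapping.keys m \<union> Poly_Mapping.keys n"
  have "Poly_Mapping.keys (m + n) \<subseteq> ?A" by (rule keys_add)
  then show ?thesis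
    by (simp add: monom_eval_superset[of ?A] lookup_add power_add prod.distrib)
qed

lemma eval_poly_superset:
  assumes "finite A" "Poly_Mapping.keys p \<subseteq> A"
  shows "eval_poly x p = (\<Sum>m\<in>A. Poly_Mapping.lookup p m * monom_eval x m)"
  unfolding eval_poly_def monom_eval_def[symmetric] using assms
  by (intro sum.mono_neutral_left) (auto simp: in_keys_iff)

lemma eval_poly_add: "eval_poly x (p + q) = eval_poly x p + eval_poly x q"
proof -
  let ?A = "Poly_Mapping.keys p \<union> Poly_Mapping.keys q"
  have "Poly_Mapping.keys (p + q) \<subseteq> ?A" by (rule keys_add)
  then show ?thesis
    by (simp add: eval_poly_superset[of ?A] lookup_add distrib_right sum.distrib)
qed

lemma eval_poly_0: "eval_poly x 0 = 0"
  by (simp add: eval_poly_def)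

lemma eval_poly_diff: "eval_poly x (p - q) = eval_poly x p - eval_poly x q"
  using eval_poly_add[of x "p - q" q] by simp

lemma eval_poly_single: "eval_poly x (Poly_Mapping.single m c) = c * monom_eval x m"
  by (simp add: eval_poly_def monom_eval_def)

lemma eval_poly_sum: "eval_poly x (sum f A) = (\<Sum>a\<in>A. eval_poly x (f a))"
  by (induction A rule: infinite_finite_induct) (auto simp: eval_poly_0 eval_poly_add)

lemma poly_mapping_eq_sum_single:
  "p = (\<Sum>m\<in>Poly_Mapping.keys p. Poly_Mapping.single m (Poly_Mapping.lookup p m))"
  by (rule poly_mapping_eqI)
    (auto simp: lookup_sum lookup_single when_def in_keys_iff)

text \<open>Expanding both factors into single terms reduces the claim to
  \<open>monom_eval_add\<close>.\<close>

lemma eval_poly_mult: "eval_poly x (p * q) = eval_poly x p * eval_poly x q"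
proof -
  let ?s = "\<lambda>p m. Poly_Mapping.single m (Poly_Mapping.lookup p m)"
  have "p * q = (\<Sum>m\<in>Poly_Mapping.keys p. \<Sum>n\<in>Poly_Mapping.keys q. ?s p m * ?s q n)"
    by (subst (1) poly_mapping_eq_sum_single[of p], subst (1) poly_mapping_eq_sum_single[of q])
      (rule sum_product)
  then have "eval_poly x (p * q) =
      (\<Sum>m\<in>Poly_Mapping.keys p. \<Sum>n\<in>Poly_Mapping.keys q. eval_poly x (?s p m) * eval_poly x (?s q n))"
    by (simp add: eval_poly_sum mult_single eval_poly_single monom_eval_add mult_ac)
  also have "\<dots> = eval_poly x (\<Sum>m\<in>Poly_Mapping.keys p. ?s p m) * eval_poly x (\<Sum>n\<in>Poly_Mapping.keys q. ?s q n)"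
    by (simp add: eval_poly_sum sum_product)
  finally show ?thesis
    unfolding poly_mapping_eq_sum_single[of p, symmetric] poly_mapping_eq_sum_single[of q, symmetric] .
qed

lemma eval_poly_1: "eval_poly x 1 = 1"
  using eval_poly_single[of x 0 1] by (simp add: monom_eval_def)

lemma eval_poly_power: "eval_poly x (p ^ n) = eval_poly x p ^ n"
  by (induction n) (auto simp: eval_poly_1 eval_poly_mult)

lemmas eval_poly_hom = eval_poly_0 eval_poly_1 eval_poly_add eval_poly_diff eval_poly_mult
  eval_poly_power eval_poly_sum

lemma continuous_on_eval_poly: "continuous_on A (\<lambda>x. eval_poly x p)"
  unfolding eval_poly_def
  by (intro continuous_intros continuous_on_product_coordinates[THEN continuous_on_subset]) auto

section \<open>Variables and polynomials of bounded degree\<close>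

definition poly_var :: "'v \<Rightarrow> 'v rpoly" where
  "poly_var v = Poly_Mapping.single (Poly_Mapping.single v 1) 1"

lemma eval_poly_var: "eval_poly x (poly_var v) = x v"
  by (simp add: poly_var_def eval_poly_single monom_eval_def)

text \<open>The space from which \<open>k_sos_mod\<close> draws its squares and, for
  \<open>k = 1\<close>, \<open>theta_body\<close> its affine functions.\<close>

definition poly_le :: "'v set \<Rightarrow> nat \<Rightarrow> 'v rpoly set" where
  "poly_le N k = {p \<in> poly_ring N. total_degree p \<le> k}"

lemma poly_le_iff:
  "p \<in> poly_le N k \<longleftrightarrow>
     (\<forall>m\<in>Poly_Mapping.keys p. Poly_Mapping.keys m \<subseteq> N \<and> monom_degree m \<le> k)"
  unfolding poly_le_def poly_ring_def total_degree_def by auto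

lemma monom_degree_superset:
  assumes "finite A" "Poly_Mapping.keys m \<subseteq> A"
  shows "monom_degree m = (\<Sum>v\<in>A. Poly_Mapping.lookup m v)"
  unfolding monom_degree_def using assms by (intro sum.mono_neutral_left) (auto simp: in_keys_iff)

lemma monom_degree_add: "monom_degree (m + n) = monom_degree m + monom_degree n"
proof -
  let ?A = "Poly_Mapping.keys m \<union> Poly_Mapping.keys n"
  have "Poly_Mapping.keys (m + n) \<subseteq> ?A" by (rule keys_add)
  then show ?thesis
    by (simp add: monom_degree_superset[of ?A] lookup_add sum.distrib)
qed

lemma poly_le_add: "p \<in> poly_le N k \<Longrightarrow> q \<in> poly_le N k \<Longrightarrow> p + q \<in> poly_le N k"
  using keys_add[of p q] unfolding poly_le_iff by blast

lemma poly_le_diff: "p \<in> poly_le N k \<Longrightarrow> q \<in> poly_le N k \<Longrightarrow> p - q \<in> poly_le N k"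
  using keys_diff[of p q] unfolding poly_le_iff by blast

lemma poly_le_mult:
  assumes "p \<in> poly_le N k" "q \<in> poly_le N l"
  shows "p * q \<in> poly_le N (k + l)"
  unfolding poly_le_iff
proof
  fix m assume "m \<in> Poly_Mapping.keys (p * q)"
  then obtain a b where m: "m = a + b" "a \<in> Poly_Mapping.keys p" "b \<in> Poly_Mapping.keys q"
    using keys_mult[of p q] by blast
  then show "Poly_Mapping.keys m \<subseteq> N \<and> monom_degree m \<le> k + l"
    using assms keys_add[of a b] unfolding poly_le_iff m(1) monom_degree_add
    by (meson Un_least add_mono order_trans)
qed

lemma poly_le_mono: "p \<in> poly_le N k \<Longrightarrow> k \<le> l \<Longrightarrow> p \<in> poly_le N l"
  unfolding poly_le_def by auto

lemma poly_le_1: "1 \<in> poly_le N k"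
  by (auto simp: poly_le_iff monom_degree_def)

lemma poly_le_var: "v \<in> N \<Longrightarrow> poly_var v \<in> poly_le N 1"
  by (auto simp: poly_le_iff poly_var_def monom_degree_def)

lemma poly_ring_add: "p \<in> poly_ring N \<Longrightarrow> q \<in> poly_ring N \<Longrightarrow> p + q \<in> poly_ring N"
  using keys_add[of p q] unfolding poly_ring_def by blast

lemma poly_ring_diff: "p \<in> poly_ring N \<Longrightarrow> q \<in> poly_ring N \<Longrightarrow> p - q \<in> poly_ring N"
  using keys_diff[of p q] unfolding poly_ring_def by blast

lemma poly_ring_power2:
  assumes "p \<in> poly_ring N"
  shows "p\<^sup>2 \<in> poly_ring N"
  using poly_le_mult[of p N "total_degree p" p "total_degree p"] assms
  by (auto simp: poly_le_def power2_eq_square)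

lemma poly_ring_sum: "(\<And>a. a \<in> A \<Longrightarrow> f a \<in> poly_ring N) \<Longrightarrow> sum f A \<in> poly_ring N"
  by (induction A rule: infinite_finite_induct) (simp_all add: poly_ring_add, simp_all add: poly_ring_def)

section \<open>Theta bodies of vanishing ideals\<close>

text \<open>Membership in a vanishing ideal is tested by evaluation, so a certificate need only hold
  pointwise on \<open>S\<close>. A list lets explicit squares be written down, repeated where a
  coefficient is wanted.\<close>

lemma k_sos_mod_vanishingI:
  assumes "f \<in> poly_le N l" "\<And>p. p \<in> set ps \<Longrightarrow> p \<in> poly_le N k"
    and "\<And>x. x \<in> S \<Longrightarrow> eval_poly x f = (\<Sum>p\<leftarrow>ps. (eval_poly x p)\<^sup>2)"
  shows "k_sos_mod N k (vanishing_ideal N S) f"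
  unfolding k_sos_mod_def
proof (intro exI conjI allI impI)
  fix j assume "j < length ps"
  then have "ps ! j \<in> poly_le N k" using assms(2) by simp
  then show "ps ! j \<in> poly_ring N" "total_degree (ps ! j) \<le> k" by (auto simp: poly_le_def)
next
  have "f - (\<Sum>j<length ps. (ps ! j)\<^sup>2) \<in> poly_ring N"
    using assms(1,2) by (intro poly_ring_diff poly_ring_sum poly_ring_power2) (auto simp: poly_le_def)
  moreover have "eval_poly x (f - (\<Sum>j<length ps. (ps ! j)\<^sup>2)) = 0" if "x \<in> S" for x
    using assms(3)[OF that] by (simp add: eval_poly_hom sum_list_sum_nth atLeast0LessThan)
  ultimately show "f - (\<Sum>j<length ps. (ps ! j)\<^sup>2) \<in> vanishing_ideal N S"
    by (auto simp: vanishing_ideal_def)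
qed

lemma theta_body_vanishingD:
  assumes "x \<in> theta_body N k (vanishing_ideal N S)"
    and "f \<in> poly_le N 1" "\<And>p. p \<in> set ps \<Longrightarrow> p \<in> poly_le N k"
    and "\<And>y. y \<in> S \<Longrightarrow> eval_poly y f = (\<Sum>p\<leftarrow>ps. (eval_poly y p)\<^sup>2)"
  shows "0 \<le> eval_poly x f"
  using assms(1) k_sos_mod_vanishingI[OF assms(2-4)] assms(2)
  by (auto simp: theta_body_def poly_le_def)

text \<open>At a point of \<open>S\<close> the ideal contributes nothing, so \<open>f\<close> takes
  the value of a sum of squares.\<close>

lemma mem_theta_body_vanishing:
  assumes "x \<in> S" "x \<in> N \<rightarrow>\<^sub>E UNIV"
  shows "x \<in> theta_body N k (vanishing_ideal N S)"
proof -
  have "0 \<le> eval_poly x f" if "k_sos_mod N k (vanishing_ideal N S) f" for f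
  proof -
    obtain m :: nat and g where "f - (\<Sum>j<m. (g j)\<^sup>2) \<in> vanishing_ideal N S"
      using \<open>k_sos_mod N k (vanishing_ideal N S) f\<close> unfolding k_sos_mod_def by blast
    then have "eval_poly x (f - (\<Sum>j<m. (g j)\<^sup>2)) = 0" using assms(1) by (auto simp: vanishing_ideal_def)
    then have "eval_poly x f = (\<Sum>j<m. (eval_poly x (g j))\<^sup>2)" by (simp add: eval_poly_hom)
    then show ?thesis by (simp add: sum_nonneg)
  qed
  then show ?thesis using assms(2) by (auto simp: theta_body_def)
qed

section \<open>Compactness of theta bodies\<close>

lemma compact_PiE_real:
  "compact (PiE N (\<lambda>_. {a..b::real}))"
proof -
  \<comment> \<open>Coordinates outside \<open>N\<close> are fixed at \<open>undefined\<close>, so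
    the box is a full product with singleton factors there and Tychonoff's theorem applies.\<close>
  have "PiE N (\<lambda>_. {a..b}) = PiE UNIV (\<lambda>v. if v \<in> N then {a..b} else {undefined})"
    by (auto simp: PiE_iff extensional_def split: if_splits)
  also have "compactin (product_topology (\<lambda>_. euclidean) UNIV) \<dots>"
    by (subst compactin_PiE) auto
  finally show ?thesis by (simp add: euclidean_product_topology)
qed

text \<open>Polynomials are continuous, so a theta body is cut out of the box by closed
  conditions.\<close>

lemma compact_theta_body:
  assumes "theta_body N k I \<subseteq> PiE N (\<lambda>_. {a..b})"
  shows "compact (theta_body N k I)"
proof -
  let ?F = "{f \<in> poly_ring N. total_degree f \<le> 1 \<and> k_sos_mod N k I f}"
  have "theta_body N k I = PiE N (\<lambda>_. {a..b}) \<inter> (\<Inter>f\<in>?F. {x. 0 \<le> eval_poly x f})" (is "_ = ?B \<inter> ?C")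
    using assms unfolding theta_body_def by (auto simp: PiE_iff)
  moreover have "closed ?C"
    by (intro closed_INT ballI closed_Collect_le continuous_on_const continuous_on_eval_poly)
  ultimately show ?thesis by (simp add: compact_PiE_real compact_Int_closed)
qed

section \<open>Linear inequalities valid on the second theta body\<close>

lemma theta_body_cover_ideal:
  assumes "x \<in> theta_body E 2 (cover_ideal E)"
  shows "x \<in> PiE E (\<lambda>_. {0..1})" and "fractional_cover E x"
proof -
  let ?S = "char_vec E ` {C. triangle_cover E C}"
  note D = theta_body_vanishingD[OF assms[unfolded cover_ideal_def]]
  have var: "poly_var e \<in> poly_le E k" "1 - poly_var e \<in> poly_le E k" if "e \<in> E" "1 \<le> k" for e k
    using that by (auto intro!: poly_le_diff poly_le_1 intro: poly_le_mono[OF poly_le_var])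
  \<comment> \<open>On 0/1 vectors both \<open>x e\<close> and \<open>1 - x e\<close> equal their
    own squares.\<close>
  have x01: "0 \<le> x e \<and> x e \<le> 1" if e: "e \<in> E" for e
  proof
    have "0 \<le> eval_poly x (poly_var e)"
      by (rule D[where ps = "[poly_var e]"])
        (use e in \<open>auto simp: var eval_poly_var char_vec_def indicator_def\<close>)
    then show "0 \<le> x e" by (simp add: eval_poly_var)
    have "0 \<le> eval_poly x (1 - poly_var e)"
      by (rule D[where ps = "[1 - poly_var e]"])
        (use e in \<open>auto simp: var eval_poly_hom eval_poly_var char_vec_def indicator_def\<close>)
    then show "x e \<le> 1" by (simp add: eval_poly_hom eval_poly_var)
  qed
  then show "x \<in> PiE E (\<lambda>_. {0..1})" using assms by (auto simp: theta_body_def PiE_iff)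
  have "1 \<le> x {u, v} + x {v, w} + x {u, w}" if t: "is_triangle E u v w" for u v w
  proof -
    have E: "{u, v} \<in> E" "{v, w} \<in> E" "{u, w} \<in> E" using t by (auto simp: is_triangle_def)
    define a b c where "a = 1 - poly_var {u, v}" and "b = 1 - poly_var {v, w}" and "c = 1 - poly_var {u, w}"
    define f where "f = poly_var {u, v} + poly_var {v, w} + poly_var {u, w} - 1"
    \<comment> \<open>Since abc = 0 on covers, these are the indicators of the covers missing no edge of the
      triangle, and of those missing exactly the edge of a, b or c.\<close>
    define p where "p = 1 - a - b - c + a * b + b * c + a * c"
    define q1 q2 q3 where "q1 = a - a * b - a * c" and "q2 = b - a * b - b * c" and "q3 = c - a * c - b * c"
    have abc: "a \<in> poly_le E 1" "b \<in> poly_le E 1" "c \<in> poly_le E 1"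
      using var E by (auto simp: a_def b_def c_def)
    note abc2 = poly_le_mono[OF abc(1), of 2] poly_le_mono[OF abc(2), of 2] poly_le_mono[OF abc(3), of 2]
    have quad: "a * b \<in> poly_le E 2" "b * c \<in> poly_le E 2" "a * c \<in> poly_le E 2"
      using abc poly_le_mult[of _ E 1 _ 1] by (auto simp: numeral_2_eq_2)
    have "0 \<le> eval_poly x f"
    \<comment> \<open>On a cover, \<open>f\<close> is the number of covered edges of the triangle
      minus 1: it is 2 when no edge is missing, hence \<open>p\<close> twice, 1 when exactly one is
      missing, and 0 when two are.\<close>
    proof (rule D[where ps = "[p, p, q1, q2, q3]"])
      show "f \<in> poly_le E 1" using E var by (auto simp: f_def intro!: poly_le_add poly_le_diff poly_le_1)
    next
      fix r assume "r \<in> set [p, p, q1, q2, q3]"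
      then show "r \<in> poly_le E 2" using abc2 quad
        by (auto simp: p_def q1_def q2_def q3_def intro!: poly_le_add poly_le_diff poly_le_1)
    next
      fix y assume "y \<in> ?S"
      then obtain C where C: "triangle_cover E C" "y = char_vec E C" by blast
      have "{u, v} \<in> C \<or> {v, w} \<in> C \<or> {u, w} \<in> C" using C(1) t by (auto simp: triangle_cover_def)
      then have "(y {u, v} = 0 \<or> y {u, v} = 1) \<and> (y {v, w} = 0 \<or> y {v, w} = 1) \<and>
          (y {u, w} = 0 \<or> y {u, w} = 1) \<and> (y {u, v} = 1 \<or> y {v, w} = 1 \<or> y {u, w} = 1)"
        using E by (auto simp: C(2) char_vec_def indicator_def)
      moreover have "eval_poly y a = 1 - y {u, v}" "eval_poly y b = 1 - y {v, w}" "eval_poly y c = 1 - y {u, w}"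
        by (simp_all add: a_def b_def c_def eval_poly_hom eval_poly_var)
      ultimately show "eval_poly y f = (\<Sum>p\<leftarrow>[p, p, q1, q2, q3]. (eval_poly y p)\<^sup>2)"
        by (auto simp: f_def p_def q1_def q2_def q3_def eval_poly_hom eval_poly_var)
    qed
    then show ?thesis by (simp add: f_def eval_poly_hom eval_poly_var)
  qed
  then show "fractional_cover E x" using x01 by (auto simp: fractional_cover_def)
qed

text \<open>Compactness makes the \<^const>\<open>Least\<close> in \<^const>\<open>tau_dagger\<close> a genuine minimum.\<close>

lemma tau_dagger_attained:
  "\<exists>x\<in>theta_body E 2 (cover_ideal E). tau_dagger E = (\<Sum>e\<in>E. x e)"
proof -
  let ?T = "theta_body E 2 (cover_ideal E)"
  have "compact ?T" using theta_body_cover_ideal(1) by (intro compact_theta_body) blast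
  moreover have "?T \<noteq> {}"
  proof -
    \<comment> \<open>The full edge set supplies a point of the theta body.\<close>
    have "triangle_cover E E" by (auto simp: triangle_cover_def is_triangle_def)
    then have "char_vec E E \<in> ?T" unfolding cover_ideal_def
      by (intro mem_theta_body_vanishing) (auto simp: char_vec_def)
    then show ?thesis by blast
  qed
  moreover have "continuous_on ?T (\<lambda>x. \<Sum>e\<in>E. x e)"
    by (intro continuous_on_sum continuous_on_product_coordinates[THEN continuous_on_subset]) auto
  ultimately obtain x where x: "x \<in> ?T" "\<And>y. y \<in> ?T \<Longrightarrow> (\<Sum>e\<in>E. x e) \<le> (\<Sum>e\<in>E. y e)"
    using continuous_attains_inf by metis
  have "tau_dagger E = (\<Sum>e\<in>E. x e)"
    unfolding tau_dagger_def by (rule Least_equality) (use x in auto)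
  then show ?thesis using x(1) by blast
qed

theorem theorem4p4:
  fixes V :: "'a set" and E :: "'a set set"
  assumes "finite_simple_graph V E"
  shows "tau_dagger E \<ge> real (tau E) / 2"
proof -
  obtain x where x: "x \<in> theta_body E 2 (cover_ideal E)" "tau_dagger E = (\<Sum>e\<in>E. x e)"
    using tau_dagger_attained by blast
  obtain C where C: "triangle_cover E C" "real (card C) \<le> 2 * sum x E"
    using ex_triangle_cover_le_fractional[OF assms theta_body_cover_ideal(2)[OF x(1)]] by blast
  have "tau E \<le> card C" using finite_simple_graph_finite[OF assms] C(1) by (rule tau_le_card)
  then show ?thesis using C(2) x(2) by linarith
qed

end
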